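(* Let $0<a<1$, let $\hat e\in\mathbb{S}^2$ be a fixed unit vector, and let $$c(x,y)=\log\left(1-\frac{(1-a^2)(1-x\cdot y)}{2(1-a\,x\cdot\hat e)(1-a\,y\cdot\hat e)}\right)$$ be the point-to-point cost function on the sphere. Then $c$ does not satisfy the condition $\mathbf{Aw}$ (non-negativity of the cost-sectional curvature).
   Context: $\mathbb{S}^2\subset\mathbb{R}^3$ is the unit sphere with the metric induced from $\mathbb{R}^3$. $\nabla_x c$ is the gradient on the sphere in the variable $x$, and $\nabla^2_{xx}c$ is the Hessian on the sphere in $x$, computed as $D^2_{xx}c-(D_xc\cdot x)\,\mathrm{Id}$ with $D$ the Euclidean derivatives in $\mathbb{R}^3$. For $p\in T_x\mathbb{S}^2$, let $T(x,p)$ be the point $y$ determined by $p=-\nabla_x c(x,y)$. The cost-sectional curvature is $$\mathfrak{G}_c(x,y)(\xi,\eta)=-\sum_{i,j,k,l}D_{p_ip_j}\left(\nabla^2_{xx}c(x,y)\big|_{y=T(x,p)}\right)_{kl}\xi_i\xi_j\eta_k\eta_l,\qquad\text{evaluated at }p=-\nabla_xc(x,y).$$ Condition $\mathbf{Aw}$: the cost-sectional curvature is non-negative on the domain $D\subset\mathbb{S}^2\times\mathbb{S}^2$ on which the cost is considered, that is, for all $(x,y)\in D$ and all $\xi,\eta\in T_x\mathbb{S}^2$ with $\xi\perp\eta$, one has $\mathfrak{G}_c(x,y)(\xi,\eta)\ge0$. *)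

theory Defs
  imports "HOL-Analysis.Analysis"
begin

text \<open>
  A cost function is represented by a function of type \<open>real^3 \<Rightarrow> real^3 \<Rightarrow> real\<close> that is smooth in
  a neighbourhood of every pair of a domain \<open>D\<close> contained in \<open>sphere 0 1 \<times> sphere 0 1\<close>; this is what
  gives a meaning to its Euclidean derivatives. The tangential gradient and the restriction
  of the Hessian to tangent vectors depend only on the values of the cost on the sphere.
\<close>

definition euclidean_grad :: "(real^3 \<Rightarrow> real) \<Rightarrow> real^3 \<Rightarrow> real^3" where
  "euclidean_grad f x = (THE g. GDERIV f x :> g)"

definition sphere_tangent :: "real^3 \<Rightarrow> (real^3) set" where
  "sphere_tangent x = {v. v \<bullet> x = 0}"

definition sphere_grad :: "(real^3 \<Rightarrow> real) \<Rightarrow> real^3 \<Rightarrow> real^3" where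
  "sphere_grad f x = euclidean_grad f x - (euclidean_grad f x \<bullet> x) *\<^sub>R x"

definition sphere_hessian :: "(real^3 \<Rightarrow> real) \<Rightarrow> real^3 \<Rightarrow> real^3^3" where
  "sphere_hessian f x = jacobian (euclidean_grad f) (at x) - mat (euclidean_grad f x \<bullet> x)"

definition cost_map ::
    "(real^3 \<Rightarrow> real^3 \<Rightarrow> real) \<Rightarrow> ((real^3) \<times> (real^3)) set \<Rightarrow> real^3 \<Rightarrow> real^3 \<Rightarrow> real^3" where
  "cost_map c D x p = (THE y. (x, y) \<in> D \<and> p = - sphere_grad (\<lambda>z. c z y) x)"

text \<open>
  The indices \<open>i, j, k, l\<close> of the cost-sectional curvature refer to coordinates on the tangent
  plane with respect to an orthonormal basis. For a smooth cost the curvature does not depend on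
  the basis, so any choice will do.
\<close>

definition is_tangent_frame :: "real^3 \<Rightarrow> (2 \<Rightarrow> real^3) \<Rightarrow> bool" where
  "is_tangent_frame x E \<longleftrightarrow>
     (\<forall>i. E i \<in> sphere_tangent x) \<and> (\<forall>i j. E i \<bullet> E j = (if i = j then 1 else 0))"

lemma tangent_frame_exists:
  assumes x: "x \<in> sphere 0 1"
  shows "\<exists>E. is_tangent_frame x E"
proof -
  have nx: "norm x = 1" using x by simp
  obtain u where u: "u \<noteq> 0" "orthogonal x u"
    by (rule orthogonal_to_vector_exists[of x]) auto
  define v where "v = sgn u"
  define w where "w = cross3 x v"
  have v: "norm v = 1" "v \<bullet> x = 0"
    using u by (simp_all add: v_def norm_sgn sgn_div_norm orthogonal_def inner_commute)
  have "(norm w)\<^sup>2 = 1"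
    using norm_cross_dot[of x v] nx v by (simp add: w_def inner_commute)
  then have w: "w \<bullet> w = 1" "w \<bullet> x = 0" "w \<bullet> v = 0"
    by (simp_all add: power2_norm_eq_inner w_def dot_cross_self)
  have "is_tangent_frame x (\<lambda>i. if i = 1 then v else w)"
    unfolding is_tangent_frame_def sphere_tangent_def forall_2
    using v w by (simp add: inner_commute dot_square_norm)
  then show ?thesis by blast
qed

definition tangent_frame :: "real^3 \<Rightarrow> 2 \<Rightarrow> real^3" where
  "tangent_frame x = (SOME E. is_tangent_frame x E)"

definition partial2 :: "(real^3 \<Rightarrow> real) \<Rightarrow> real^3 \<Rightarrow> real^3 \<Rightarrow> real^3 \<Rightarrow> real" where
  "partial2 F u v p = deriv (\<lambda>s. deriv (\<lambda>t. F (p + s *\<^sub>R u + t *\<^sub>R v)) 0) 0"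

definition cost_sectional_curvature ::
    "(real^3 \<Rightarrow> real^3 \<Rightarrow> real) \<Rightarrow> ((real^3) \<times> (real^3)) set \<Rightarrow>
     real^3 \<Rightarrow> real^3 \<Rightarrow> real^3 \<Rightarrow> real^3 \<Rightarrow> real" where
  "cost_sectional_curvature c D x y \<xi> \<eta> =
     (let E = tangent_frame x;
          H = (\<lambda>k l p. E k \<bullet> (sphere_hessian (\<lambda>z. c z (cost_map c D x p)) x *v E l))
      in - (\<Sum>i\<in>UNIV. \<Sum>j\<in>UNIV. \<Sum>k\<in>UNIV. \<Sum>l\<in>UNIV.
              partial2 (H k l) (E i) (E j) (- sphere_grad (\<lambda>z. c z y) x) *
              (\<xi> \<bullet> E i) * (\<xi> \<bullet> E j) * (\<eta> \<bullet> E k) * (\<eta> \<bullet> E l)))"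

definition condition_Aw :: "(real^3 \<Rightarrow> real^3 \<Rightarrow> real) \<Rightarrow> ((real^3) \<times> (real^3)) set \<Rightarrow> bool" where
  "condition_Aw c D \<longleftrightarrow>
     (\<forall>(x, y)\<in>D. \<forall>\<xi>\<in>sphere_tangent x. \<forall>\<eta>\<in>sphere_tangent x.
        \<xi> \<bullet> \<eta> = 0 \<longrightarrow> cost_sectional_curvature c D x y \<xi> \<eta> \<ge> 0)"

definition point_to_point_arg :: "real \<Rightarrow> real^3 \<Rightarrow> real^3 \<Rightarrow> real^3 \<Rightarrow> real" where
  "point_to_point_arg a e x y =
     1 - ((1 - a\<^sup>2) * (1 - x \<bullet> y)) / (2 * (1 - a * (x \<bullet> e)) * (1 - a * (y \<bullet> e)))"

definition point_to_point_cost :: "real \<Rightarrow> real^3 \<Rightarrow> real^3 \<Rightarrow> real^3 \<Rightarrow> real" where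
  "point_to_point_cost a e x y = ln (point_to_point_arg a e x y)"

text \<open>
  The cost is considered wherever it is defined: on the sphere the argument of the logarithm is
  non-negative, and it vanishes for exactly one \<open>y\<close> for each \<open>x\<close> (for instance \<open>y = - e\<close> when
  \<open>x = e\<close>).
\<close>

definition point_to_point_domain :: "real \<Rightarrow> real^3 \<Rightarrow> ((real^3) \<times> (real^3)) set" where
  "point_to_point_domain a e =
     {(x, y). x \<in> sphere 0 1 \<and> y \<in> sphere 0 1 \<and> point_to_point_arg a e x y > 0}"

end

theory Submission
  imports Defs
begin

text \<open>
  After clearing denominators, the argument of the logarithm is affine in \<open>x\<close>, so that at \<open>x = e\<close>
  the equation \<open>p = - \<nabla>\<^sub>x c(e, y)\<close> is a rescaled stereographic projection of \<open>y\<close> from \<open>- e\<close>, and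
  every tangent \<open>p\<close> is attained exactly once. Expressed through \<open>p\<close>, the Hessian on the tangent
  plane is the quadratic polynomial \<open>- p p\<^sup>T + (|p|\<^sup>2 / 2 - C) Id\<close> with a constant \<open>C\<close>, hence the
  cost-sectional curvature is \<open>- |\<xi>|\<^sup>2 |\<eta>|\<^sup>2\<close> for orthogonal \<open>\<xi>\<close>, \<open>\<eta>\<close>. It has the sign opposite
  to that of the reflector cost \<open>- ln (1 - x \<bullet> y)\<close>.
\<close>

section \<open>Euclidean gradient and spherical Hessian from computed derivatives\<close>

lemma GDERIV_unique:
  assumes "GDERIV f x :> g" and "GDERIV f x :> h"
  shows "g = h"
proof -
  have "(\<lambda>v. v \<bullet> g) = (\<lambda>v. v \<bullet> h)"
    using assms unfolding gderiv_def by (rule has_derivative_unique)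
  then show ?thesis by (simp add: fun_eq_iff vector_eq_ldot)
qed

lemma euclidean_grad_eq: "GDERIV f x :> g \<Longrightarrow> euclidean_grad f x = g"
  unfolding euclidean_grad_def by (blast intro: GDERIV_unique)

lemma mat_mult_vec: "mat k *v (v :: real^'n) = k *\<^sub>R v"
  by (simp add: vec_eq_iff matrix_vector_mult_def mat_def if_distrib[of "\<lambda>t. t * _"] cong: if_cong)

text \<open>Uniqueness of the Frechet derivative identifies the action of \<open>jacobian\<close>
  with any computed derivative \<open>L\<close>, so the Hessian can be handled without matrix
  entries.\<close>

lemma sphere_hessian_mult_vec:
  assumes "(euclidean_grad f has_derivative L) (at x)"
  shows "sphere_hessian f x *v v = L v - (euclidean_grad f x \<bullet> x) *\<^sub>R v"
proof -
  have "(euclidean_grad f has_derivative (\<lambda>h. jacobian (euclidean_grad f) (at x) *v h)) (at x)"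
    using assms jacobian_works differentiableI by blast
  then have "(\<lambda>h. jacobian (euclidean_grad f) (at x) *v h) = L"
    using assms by (rule has_derivative_unique)
  then show ?thesis
    by (simp add: sphere_hessian_def matrix_vector_mult_diff_rdistrib mat_mult_vec fun_eq_iff)
qed

section \<open>Derivatives of the cost through its affine numerator\<close>

definition affine_const :: "real \<Rightarrow> real^3 \<Rightarrow> real^3 \<Rightarrow> real" where
  "affine_const a e y = 1 + a\<^sup>2 - 2 * a * (y \<bullet> e)"

definition affine_slope :: "real \<Rightarrow> real^3 \<Rightarrow> real^3 \<Rightarrow> real^3" where
  "affine_slope a e y = (1 - a\<^sup>2) *\<^sub>R y - (2 * a * (1 - a * (y \<bullet> e))) *\<^sub>R e"

definition affine_num :: "real \<Rightarrow> real^3 \<Rightarrow> real^3 \<Rightarrow> real^3 \<Rightarrow> real" where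
  "affine_num a e x y = affine_const a e y + x \<bullet> affine_slope a e y"

lemma point_to_point_arg_eq:
  assumes "1 - a * (x \<bullet> e) > 0" "1 - a * (y \<bullet> e) > 0"
  shows "point_to_point_arg a e x y =
    affine_num a e x y / (2 * (1 - a * (x \<bullet> e)) * (1 - a * (y \<bullet> e)))"
proof -
  have "2 * (1 - a * (x \<bullet> e)) * (1 - a * (y \<bullet> e)) \<noteq> 0"
    using assms by simp
  then have "point_to_point_arg a e x y =
    (2 * (1 - a * (x \<bullet> e)) * (1 - a * (y \<bullet> e)) - (1 - a\<^sup>2) * (1 - x \<bullet> y)) /
      (2 * (1 - a * (x \<bullet> e)) * (1 - a * (y \<bullet> e)))"
    by (simp add: point_to_point_arg_def diff_divide_distrib)
  also have "2 * (1 - a * (x \<bullet> e)) * (1 - a * (y \<bullet> e)) - (1 - a\<^sup>2) * (1 - x \<bullet> y) = affine_num a e x y"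
    by (simp add: affine_num_def affine_const_def affine_slope_def inner_diff_right
        algebra_simps power2_eq_square)
  finally show ?thesis .
qed

text \<open>Euclidean derivatives at a point of the sphere need an open neighbourhood in the ambient
  space; on this one both logarithms that depend on \<open>z\<close> have positive
  arguments.\<close>

definition regular_set :: "real \<Rightarrow> real^3 \<Rightarrow> real^3 \<Rightarrow> (real^3) set" where
  "regular_set a e y = {z. 1 - a * (z \<bullet> e) > 0 \<and> affine_num a e z y > 0}"

lemma open_regular_set: "open (regular_set a e y)"
  unfolding regular_set_def affine_num_def
  by (intro open_Collect_conj open_Collect_less continuous_intros)

text \<open>Splitting the logarithm leaves logarithms of two affine functions of \<open>z\<close>
  and a constant, so the Euclidean Hessian is a sum of two rank-one terms.\<close>

lemma point_to_point_cost_eq: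
  assumes "1 - a * (y \<bullet> e) > 0" "z \<in> regular_set a e y"
  shows "point_to_point_cost a e z y =
    ln (affine_num a e z y) - ln (1 - a * (z \<bullet> e)) - ln (2 * (1 - a * (y \<bullet> e)))"
  using assms
  by (simp add: point_to_point_cost_def point_to_point_arg_eq regular_set_def ln_div ln_mult
      del: right_diff_distrib_numeral)

definition cost_grad :: "real \<Rightarrow> real^3 \<Rightarrow> real^3 \<Rightarrow> real^3 \<Rightarrow> real^3" where
  "cost_grad a e y z =
     (1 / affine_num a e z y) *\<^sub>R affine_slope a e y + (a / (1 - a * (z \<bullet> e))) *\<^sub>R e"

lemma GDERIV_cost:
  assumes "1 - a * (y \<bullet> e) > 0" "z \<in> regular_set a e y"
  shows "GDERIV (\<lambda>z. point_to_point_cost a e z y) z :> cost_grad a e y z"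
proof -
  have "((\<lambda>z. ln (affine_num a e z y) - ln (1 - a * (z \<bullet> e)) - ln (2 * (1 - a * (y \<bullet> e))))
    has_derivative (\<lambda>h. h \<bullet> cost_grad a e y z)) (at z)"
    using assms(2) unfolding affine_num_def regular_set_def
    by (auto intro!: derivative_eq_intros
        simp: cost_grad_def affine_num_def fun_eq_iff inner_add_right divide_simps)
  then show ?thesis
    unfolding gderiv_def using open_regular_set assms(2)
    by (rule has_derivative_transform_within_open) (simp add: point_to_point_cost_eq[OF assms(1)])
qed

lemma cost_grad_has_derivative:
  assumes "z \<in> regular_set a e y"
  shows "(cost_grad a e y has_derivative
    (\<lambda>h. - ((h \<bullet> affine_slope a e y) / (affine_num a e z y)\<^sup>2) *\<^sub>R affine_slope a e y +
         (a\<^sup>2 * (h \<bullet> e) / (1 - a * (z \<bullet> e))\<^sup>2) *\<^sub>R e)) (at z)"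
  using assms unfolding cost_grad_def[abs_def] affine_num_def regular_set_def
  by (auto intro!: derivative_eq_intros
      simp: fun_eq_iff power2_eq_square divide_simps)

lemma euclidean_grad_cost:
  assumes "1 - a * (y \<bullet> e) > 0" "z \<in> regular_set a e y"
  shows "euclidean_grad (\<lambda>z. point_to_point_cost a e z y) z = cost_grad a e y z"
  using GDERIV_cost[OF assms] by (rule euclidean_grad_eq)

lemma sphere_hessian_cost:
  assumes "1 - a * (y \<bullet> e) > 0" "x \<in> regular_set a e y"
  shows "sphere_hessian (\<lambda>z. point_to_point_cost a e z y) x *v v =
    - ((v \<bullet> affine_slope a e y) / (affine_num a e x y)\<^sup>2) *\<^sub>R affine_slope a e y +
         (a\<^sup>2 * (v \<bullet> e) / (1 - a * (x \<bullet> e))\<^sup>2) *\<^sub>R e - (cost_grad a e y x \<bullet> x) *\<^sub>R v"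
proof -
  have "(euclidean_grad (\<lambda>z. point_to_point_cost a e z y) has_derivative
    (\<lambda>h. - ((h \<bullet> affine_slope a e y) / (affine_num a e x y)\<^sup>2) *\<^sub>R affine_slope a e y +
         (a\<^sup>2 * (h \<bullet> e) / (1 - a * (x \<bullet> e))\<^sup>2) *\<^sub>R e)) (at x)"
    using cost_grad_has_derivative[OF assms(2)] open_regular_set assms(2)
    by (rule has_derivative_transform_within_open) (simp add: euclidean_grad_cost[OF assms(1)])
  from sphere_hessian_mult_vec[OF this] show ?thesis
    by (simp add: euclidean_grad_cost[OF assms])
qed

section \<open>The cost seen from the base point \<open>e\<close>\<close>

context
  fixes a :: real and e :: "real^3"
  assumes a: "0 < a" "a < 1" and e: "norm e = 1"
begin

lemma e_dot_e: "e \<bullet> e = 1"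
  using e by (simp add: dot_square_norm)

lemma abs_dot_le: "norm y = 1 \<Longrightarrow> \<bar>y \<bullet> e\<bar> \<le> 1"
  using Cauchy_Schwarz_ineq2[of y e] e by simp

lemma factor_pos: "norm y = 1 \<Longrightarrow> 1 - a * (y \<bullet> e) > 0"
proof -
  assume "norm y = 1"
  then have "y \<bullet> e \<le> 1" using abs_dot_le[of y] by simp
  then have "a * (y \<bullet> e) \<le> a * 1" using a by (intro mult_left_mono) simp_all
  then show ?thesis using a by linarith
qed

text \<open>On the unit sphere this vanishes only at \<open>y = - e\<close>, so the fibre of the
  domain over \<open>e\<close> is the sphere punctured at \<open>- e\<close>.\<close>

lemma affine_num_at_e: "affine_num a e e y = (1 - a)\<^sup>2 * (1 + y \<bullet> e)"
  by (simp add: affine_num_def affine_const_def affine_slope_def inner_diff_right e_dot_e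
      inner_commute[of e y] algebra_simps power2_eq_square)

lemma domain_at_e:
  "(e, y) \<in> point_to_point_domain a e \<longleftrightarrow> norm y = 1 \<and> 1 + y \<bullet> e > 0"
proof (cases "norm y = 1")
  case True
  define m where "m = (1 - a)\<^sup>2 / (2 * (1 - a * (e \<bullet> e)) * (1 - a * (y \<bullet> e)))"
  have "m > 0"
    unfolding m_def using factor_pos[OF e] factor_pos[OF True] a
    by (intro divide_pos_pos mult_pos_pos) simp_all
  moreover have "point_to_point_arg a e e y = m * (1 + y \<bullet> e)"
    unfolding point_to_point_arg_eq[OF factor_pos[OF e] factor_pos[OF True]]
    by (simp add: affine_num_at_e m_def)
  ultimately have "point_to_point_arg a e e y > 0 \<longleftrightarrow> 1 + y \<bullet> e > 0"
    by (simp add: zero_less_mult_iff)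
  then show ?thesis using True e by (simp add: point_to_point_domain_def)
qed (simp add: point_to_point_domain_def)

lemma e_in_regular_set: "1 + y \<bullet> e > 0 \<Longrightarrow> e \<in> regular_set a e y"
  using a by (simp add: regular_set_def affine_num_at_e e_dot_e)

text \<open>The scale of the stereographic projection in \<open>sphere_grad_at_e\<close>; it comes
  from cancelling \<open>1 - a\<close> in \<open>(1 - a\<^sup>2) / (1 - a)\<^sup>2\<close>.\<close>

definition dilation :: real where
  "dilation = (1 + a) / (1 - a)"

lemma dilation_pos: "dilation > 0"
  using a by (simp add: dilation_def)

lemma slope_over_num:
  assumes "1 + y \<bullet> e > 0"
  shows "(1 - a\<^sup>2) / affine_num a e e y = dilation / (1 + y \<bullet> e)"
proof -
  have "1 - a\<^sup>2 = (1 - a) * (1 + a)" by (simp add: power2_eq_square algebra_simps)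
  then show ?thesis
    using a by (simp add: affine_num_at_e dilation_def power2_eq_square)
qed

text \<open>Projection to the tangent plane removes every multiple of \<open>e\<close>, leaving only
  the \<open>y\<close> part of \<open>affine_slope\<close>. Up to the factor
  \<open>- dilation\<close> the result is the stereographic projection of \<open>y\<close> from
  \<open>- e\<close> onto the plane orthogonal to \<open>e\<close>.\<close>

lemma sphere_grad_at_e:
  assumes "norm y = 1" "1 + y \<bullet> e > 0"
  shows "- sphere_grad (\<lambda>z. point_to_point_cost a e z y) e =
    - (dilation / (1 + y \<bullet> e)) *\<^sub>R (y - (y \<bullet> e) *\<^sub>R e)"
proof -
  let ?N = "affine_num a e e y"
  have "cost_grad a e y e - (cost_grad a e y e \<bullet> e) *\<^sub>R e =
     ((1 - a\<^sup>2) / ?N) *\<^sub>R (y - (y \<bullet> e) *\<^sub>R e)"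
    by (simp add: cost_grad_def affine_slope_def e_dot_e inner_add_left inner_diff_left algebra_simps
        diff_divide_distrib add_divide_distrib)
  then show ?thesis
    unfolding sphere_grad_def slope_over_num[OF assms(2)]
      euclidean_grad_cost[OF factor_pos[OF assms(1)] e_in_regular_set[OF assms(2)]]
    by simp
qed

text \<open>Inverse stereographic projection: \<open>q\<close> is the squared norm of
  \<open>p\<close> after undoing the dilation, and the minus sign before \<open>p\<close> undoes the
  reflection in \<open>p = - \<nabla>c\<close>.\<close>

definition target :: "real^3 \<Rightarrow> real^3" where
  "target p = (let q = (norm p / dilation)\<^sup>2
     in ((1 - q) / (1 + q)) *\<^sub>R e - (2 / (dilation * (1 + q))) *\<^sub>R p)"

lemma target:
  assumes p: "p \<bullet> e = 0"
  defines "q \<equiv> (norm p / dilation)\<^sup>2"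
  shows "target p \<bullet> e = (1 - q) / (1 + q)" "1 + target p \<bullet> e = 2 / (1 + q)"
    "norm (target p) = 1" "1 + target p \<bullet> e > 0"
    "- sphere_grad (\<lambda>z. point_to_point_cost a e z (target p)) e = p"
proof -
  have q: "q \<ge> 0" by (simp add: q_def)
  then have q1: "1 + q > 0" by simp
  have t: "target p = ((1 - q) / (1 + q)) *\<^sub>R e - (2 / (dilation * (1 + q))) *\<^sub>R p"
    by (simp add: target_def q_def Let_def)
  show te: "target p \<bullet> e = (1 - q) / (1 + q)"
    by (simp add: t inner_diff_left p e_dot_e)
  show t1: "1 + target p \<bullet> e = 2 / (1 + q)"
    using q1 by (simp add: te field_simps)
  then show tp: "1 + target p \<bullet> e > 0"
    using q1 by simp
  have pp: "p \<bullet> p = q * dilation\<^sup>2"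
    using dilation_pos by (simp add: q_def power_divide dot_square_norm)
  have "target p \<bullet> target p = ((1 - q) / (1 + q))\<^sup>2 + (2 / (dilation * (1 + q)))\<^sup>2 * (p \<bullet> p)"
    by (simp add: t inner_diff_left inner_diff_right p inner_commute[of e p] e_dot_e power2_eq_square)
  also have "\<dots> = ((1 - q)\<^sup>2 + 4 * q) / (1 + q)\<^sup>2"
    using dilation_pos q1 by (simp add: pp power_divide power_mult_distrib add_divide_distrib)
  also have "(1 - q)\<^sup>2 + 4 * q = (1 + q)\<^sup>2"
    by (simp add: power2_eq_square algebra_simps)
  finally have "target p \<bullet> target p = 1"
    using q1 by simp
  then show nt: "norm (target p) = 1"
    by (simp add: norm_eq_1)
  have "target p - (target p \<bullet> e) *\<^sub>R e = - (2 / (dilation * (1 + q))) *\<^sub>R p"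
    unfolding te by (simp add: t)
  then show "- sphere_grad (\<lambda>z. point_to_point_cost a e z (target p)) e = p"
    unfolding sphere_grad_at_e[OF nt tp] t1 using dilation_pos q1 by simp
qed

text \<open>\<open>cost_map\<close> is a definite description, so injectivity of the projection has
  to accompany the existence of a preimage.\<close>

lemma target_unique:
  assumes y: "norm y = 1" "1 + y \<bullet> e > 0"
    and p: "p = - sphere_grad (\<lambda>z. point_to_point_cost a e z y) e"
  shows "y = target p"
proof -
  define q where "q = (norm p / dilation)\<^sup>2"
  have p': "p = - (dilation / (1 + y \<bullet> e)) *\<^sub>R (y - (y \<bullet> e) *\<^sub>R e)"
    using p sphere_grad_at_e[OF y] by simp
  have yy: "y \<bullet> y = 1" using y by (simp add: dot_square_norm)
  have "(y - (y \<bullet> e) *\<^sub>R e) \<bullet> (y - (y \<bullet> e) *\<^sub>R e) = (1 - y \<bullet> e) * (1 + y \<bullet> e)"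
    by (simp add: inner_diff_left inner_diff_right yy e_dot_e inner_commute[of e y] algebra_simps)
  then have "p \<bullet> p = (dilation / (1 + y \<bullet> e))\<^sup>2 * ((1 - y \<bullet> e) * (1 + y \<bullet> e))"
    unfolding p' by (simp add: power2_eq_square)
  \<comment> \<open>With \<open>y \<bullet> e\<close> the cosine of an angle, \<open>q\<close> is
    the squared tangent of half that angle.\<close>
  then have "q = (1 - y \<bullet> e) / (1 + y \<bullet> e)"
    using dilation_pos y(2)
    by (simp add: q_def power_divide flip: dot_square_norm) (simp add: power2_eq_square)
  then have q1: "1 + q = 2 / (1 + y \<bullet> e)" "1 - q = 2 * (y \<bullet> e) / (1 + y \<bullet> e)"
    using y(2) by (simp_all add: field_simps)
  have "target p = ((1 - q) / (1 + q)) *\<^sub>R e - (2 / (dilation * (1 + q))) *\<^sub>R p"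
    by (simp add: target_def q_def Let_def)
  also have "(1 - q) / (1 + q) = y \<bullet> e"
    using y(2) by (simp add: q1)
  also have "2 / (dilation * (1 + q)) = (1 + y \<bullet> e) / dilation"
    using dilation_pos by (simp add: q1 field_simps)
  also have "((1 + y \<bullet> e) / dilation) *\<^sub>R p = - (y - (y \<bullet> e) *\<^sub>R e)"
    unfolding p' using y(2) dilation_pos by simp
  finally show ?thesis by simp
qed

lemma cost_map_at_e:
  assumes "p \<bullet> e = 0"
  shows "cost_map (point_to_point_cost a e) (point_to_point_domain a e) e p = target p"
  unfolding cost_map_def
proof (rule the_equality)
  show "(e, target p) \<in> point_to_point_domain a e \<and>
    p = - sphere_grad (\<lambda>z. point_to_point_cost a e z (target p)) e"
    using target(3-5)[OF assms] by (simp add: domain_at_e)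
qed (auto simp: domain_at_e intro: target_unique)

section \<open>The Hessian as a polynomial in \<open>p\<close>, and the curvature\<close>

lemma hessian_at_e:
  assumes p: "p \<bullet> e = 0" and v: "v \<bullet> e = 0" and w: "w \<bullet> e = 0"
  shows "v \<bullet> (sphere_hessian (\<lambda>z. point_to_point_cost a e z (target p)) e *v w) =
    - (p \<bullet> v) * (p \<bullet> w) + ((p \<bullet> p) / 2 - dilation / 2) * (v \<bullet> w)"
proof -
  define y where "y = target p"
  define q where "q = (norm p / dilation)\<^sup>2"
  have q: "1 + q > 0" by (simp add: q_def add_pos_nonneg)
  have Y: "y \<bullet> e = (1 - q) / (1 + q)" "1 + y \<bullet> e = 2 / (1 + q)" "norm y = 1" "1 + y \<bullet> e > 0"
    using target(1-4)[OF p] by (simp_all add: y_def q_def)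
  let ?N = "affine_num a e e y" and ?b = "affine_slope a e y"
  have N: "?N = 2 * (1 - a)\<^sup>2 / (1 + q)" by (simp add: affine_num_at_e Y(2))
  have pN: "p = - ((1 - a\<^sup>2) / ?N) *\<^sub>R (y - (y \<bullet> e) *\<^sub>R e)"
    unfolding slope_over_num[OF Y(4)]
    using target(5)[OF p, folded y_def, unfolded sphere_grad_at_e[OF Y(3,4)]] by (rule sym)
  \<comment> \<open>On tangent vectors the normalised slope acts as \<open>- p\<close>, so the
    rank-one term of the numerator becomes \<open>- p p^T\<close>.\<close>
  have dot: "(u \<bullet> ?b) / ?N = - (p \<bullet> u)" if "u \<bullet> e = 0" for u
    unfolding pN using that
    by (simp add: affine_slope_def inner_diff_left inner_diff_right inner_commute[of e u] inner_commute[of y u])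
  have be: "?b \<bullet> e = ((1 + a\<^sup>2) * (1 - q) - 2 * a * (1 + q)) / (1 + q)"
    using q by (simp add: affine_slope_def inner_diff_left e_dot_e Y(1) divide_simps)
      (simp add: algebra_simps power2_eq_square)
  have pp: "p \<bullet> p = q * ((1 + a) / (1 - a))\<^sup>2"
    using dilation_pos by (simp add: q_def power_divide dot_square_norm flip: dilation_def)
  have "cost_grad a e y e \<bullet> e = (?b \<bullet> e) / ?N + a / (1 - a)"
    by (simp add: cost_grad_def inner_add_left e_dot_e)
  \<comment> \<open>The factor \<open>1 + q\<close> cancels between \<open>?b \<bullet> e\<close>
    and \<open>?N\<close>; hence the radial derivative is affine in \<open>q\<close>, that is,
    quadratic in \<open>p\<close>.\<close>
  also have "(?b \<bullet> e) / ?N = ((1 + a\<^sup>2) * (1 - q) - 2 * a * (1 + q)) / (2 * (1 - a)\<^sup>2)"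
    unfolding be N using q by simp
  also have "\<dots> + a / (1 - a) = dilation / 2 - (p \<bullet> p) / 2"
  proof -
    have "(1 + a\<^sup>2) * (1 - q) - 2 * a * (1 + q) = (1 - a)\<^sup>2 - q * (1 + a)\<^sup>2"
      by (simp add: algebra_simps power2_eq_square)
    moreover have "a / (1 - a) = dilation / 2 - 1 / 2"
      using a by (simp add: dilation_def field_simps)
    ultimately show ?thesis
      unfolding pp using a by (simp add: diff_divide_distrib power_divide)
  qed
  finally have g: "cost_grad a e y e \<bullet> e = dilation / 2 - (p \<bullet> p) / 2" .
  have "v \<bullet> (sphere_hessian (\<lambda>z. point_to_point_cost a e z y) e *v w) =
    - ((w \<bullet> ?b) / ?N) * ((v \<bullet> ?b) / ?N) - (cost_grad a e y e \<bullet> e) * (v \<bullet> w)"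
    unfolding sphere_hessian_cost[OF factor_pos[OF Y(3)] e_in_regular_set[OF Y(4)]]
    by (simp add: inner_diff_right inner_add_right v w power2_eq_square)
  then show ?thesis
    unfolding dot[OF v] dot[OF w] g by (simp add: algebra_simps flip: y_def)
qed

lemma partial2_hessian_at_e:
  assumes E: "is_tangent_frame e E"
  shows "partial2 (\<lambda>p. E k \<bullet> (sphere_hessian (\<lambda>z. point_to_point_cost a e z
      (cost_map (point_to_point_cost a e) (point_to_point_domain a e) e p)) e *v E l))
      (E i) (E j) 0 =
    (E i \<bullet> E j) * (E k \<bullet> E l) - (E i \<bullet> E k) * (E j \<bullet> E l) - (E i \<bullet> E l) * (E j \<bullet> E k)"
    (is "partial2 ?F _ _ _ = _")
proof -
  have T: "E n \<bullet> e = 0" for n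
    using E by (simp add: is_tangent_frame_def sphere_tangent_def)
  have F: "?F (0 + s *\<^sub>R E i + t *\<^sub>R E j) =
    - (s * (E i \<bullet> E k) + t * (E j \<bullet> E k)) * (s * (E i \<bullet> E l) + t * (E j \<bullet> E l))
    + ((s * s * (E i \<bullet> E i) + 2 * s * t * (E i \<bullet> E j) + t * t * (E j \<bullet> E j)) / 2 - dilation / 2)
      * (E k \<bullet> E l)" for s t
  proof -
    have "(0 + s *\<^sub>R E i + t *\<^sub>R E j) \<bullet> e = 0" by (simp add: inner_add_left T)
    then show ?thesis
      by (simp add: cost_map_at_e hessian_at_e T inner_add_left inner_add_right
          inner_commute[of "E j" "E i"] algebra_simps)
  qed
  \<comment> \<open>For fixed \<open>s\<close> this is a quadratic polynomial in \<open>t\<close>.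
    Its linear coefficient comes from the mixed terms \<open>s * t\<close> alone and is therefore
    proportional to \<open>s\<close>.\<close>
  have "deriv (\<lambda>t. ?F (0 + s *\<^sub>R E i + t *\<^sub>R E j)) 0 =
    s * ((E i \<bullet> E j) * (E k \<bullet> E l) - (E i \<bullet> E k) * (E j \<bullet> E l) - (E i \<bullet> E l) * (E j \<bullet> E k))" for s
    unfolding F
    by (rule DERIV_imp_deriv) (auto intro!: derivative_eq_intros simp: algebra_simps)
  then show ?thesis
    unfolding partial2_def by (simp add: deriv_cmult_right)
qed

text \<open>The choice \<open>y = e\<close> corresponds to \<open>p = 0\<close>. By orthonormality,
  only \<open>i = j = 1\<close>, \<open>k = l = 2\<close> contributes; that second derivative is
  \<open>1\<close>, from the \<open>|p|^2 / 2\<close> part of the Hessian, and the sign in the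
  definition makes it \<open>- 1\<close>.\<close>

lemma curvature_at_e:
  assumes "E = tangent_frame e"
  shows "cost_sectional_curvature (point_to_point_cost a e) (point_to_point_domain a e) e e
    (E 1) (E 2) = - 1"
proof -
  have E: "is_tangent_frame e E"
    using someI_ex[OF tangent_frame_exists[of e]] e by (simp add: assms tangent_frame_def)
  have grad: "- sphere_grad (\<lambda>z. point_to_point_cost a e z e) e = 0"
    by (subst sphere_grad_at_e) (simp_all add: e e_dot_e)
  have I: "E i \<bullet> E j = (if i = j then 1 else 0)" for i j
    using E by (simp add: is_tangent_frame_def)
  show ?thesis
    unfolding cost_sectional_curvature_def Let_def grad assms[symmetric] partial2_hessian_at_e[OF E]
    by (simp add: sum_2 I)
qed

end

theorem theorem15:
  fixes a :: real and e :: "real^3"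
  assumes "0 < a" and "a < 1" and "e \<in> sphere 0 1"
  shows "\<not> condition_Aw (point_to_point_cost a e) (point_to_point_domain a e)"
proof
  assume Aw: "condition_Aw (point_to_point_cost a e) (point_to_point_domain a e)"
  have e: "norm e = 1" using assms(3) by simp
  let ?E = "tangent_frame e"
  have E: "is_tangent_frame e ?E"
    using someI_ex[OF tangent_frame_exists[OF assms(3)]] by (simp add: tangent_frame_def)
  \<comment> \<open>The pole \<open>y = e\<close> is antipodal to the excluded point
    \<open>- e\<close>, so the diagonal pair can serve as the counterexample.\<close>
  have "(e, e) \<in> point_to_point_domain a e"
    using domain_at_e[OF assms(1,2) e] e by (simp add: dot_square_norm)
  moreover have "?E 1 \<in> sphere_tangent e" "?E 2 \<in> sphere_tangent e" "?E 1 \<bullet> ?E 2 = 0"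
    using E by (simp_all add: is_tangent_frame_def)
  ultimately have "cost_sectional_curvature (point_to_point_cost a e) (point_to_point_domain a e) e e
      (?E 1) (?E 2) \<ge> 0"
    using Aw unfolding condition_Aw_def by blast
  then show False
    using curvature_at_e[OF assms(1,2) e refl] by simp
qed

end
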